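(* Let $\mathbf{F}:\mathbb{R}^n\to\mathbb{R}^n$ be of class $C^r$ ($r\ge 1$) near $0$ and let $\mathbf{x}_0=0$ be a hyperbolic singularity of the system $\dot{\mathbf{x}}=\mathbf{F}(\mathbf{x})$, $\mathbf{x}\in\mathbb{R}^n$, such that all the eigenvalues of $D\mathbf{F}(0)$ have negative real part, and let $\phi_1$ be the corresponding unit-time map. Then there exists $\rho>0$ such that for the sequence $S(\mathbf{x}_1)=(\mathbf{x}_k)_{k\in\mathbb{N}}$ defined by $\mathbf{x}_{k+1}=\phi_1(\mathbf{x}_k)$, $\|\mathbf{x}_1\|<\rho$, we have $\dim_BS(\mathbf{x}_1)=0$.
   Context: A singularity of $\dot{\mathbf{x}}=\mathbf{F}(\mathbf{x})$ is a point $\mathbf{x}_0$ with $\mathbf{F}(\mathbf{x}_0)=0$; it is hyperbolic if no eigenvalue of $D\mathbf{F}(\mathbf{x}_0)$ has zero real part. The unit-time map $\phi_1$ is the time-$1$ map of the flow $\phi_t$ of the system (defined near $0$). A sequence is identified with its set of points. Box dimension: for a bounded set $A\subset\mathbb{R}^N$ let $A_\varepsilon=\{y\in\mathbb{R}^N: d(y,A)<\varepsilon\}$ and let $|A_\varepsilon|$ be its Lebesgue measure. For $s\ge 0$ put $\mathcal{M}_*^s(A)=\liminf_{\varepsilon\to0}|A_\varepsilon|/\varepsilon^{N-s}$ and $\mathcal{M}^{*s}(A)=\limsup_{\varepsilon\to0}|A_\varepsilon|/\varepsilon^{N-s}$. The lower and upper box dimensions are $\underline{\dim}_B A=\inf\{s>0:\mathcal{M}_*^s(A)=0\}$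 and $\overline{\dim}_B A=\inf\{s>0:\mathcal{M}^{*s}(A)=0\}$; if they coincide, the common value is denoted $\dim_B A$. The assertion $\dim_B A=d$ includes that both coincide. *)

theory Defs
  imports "HOL-Analysis.Analysis"
begin

text \<open>\<open>f\<close> is of class \<open>C\<^sup>k\<close> on \<open>U\<close>; intended for open \<open>U\<close> only.\<close>

fun Ck_on :: "nat \<Rightarrow> ('a::euclidean_space \<Rightarrow> 'b::real_normed_vector) \<Rightarrow> 'a set \<Rightarrow> bool" where
  "Ck_on 0 f U \<longleftrightarrow> continuous_on U f"
| "Ck_on (Suc k) f U \<longleftrightarrow> (\<forall>x\<in>U. f differentiable (at x)) \<and>
     (\<forall>b\<in>Basis. Ck_on k (\<lambda>x. frechet_derivative f (at x) b) U)"

definition Ck_near :: "nat \<Rightarrow> ('a::euclidean_space \<Rightarrow> 'b::real_normed_vector) \<Rightarrow> 'a \<Rightarrow> bool" where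
  "Ck_near k f x \<longleftrightarrow> (\<exists>U. open U \<and> x \<in> U \<and> Ck_on k f U)"

definition complex_eigenvalues :: "real^'n^'n \<Rightarrow> complex set" where
  "complex_eigenvalues A =
     {c. \<exists>v::complex^'n. v \<noteq> 0 \<and> (\<chi> i j. complex_of_real (A $ i $ j)) *v v = c *s v}"

definition hyperbolic_singularity :: "(real^'n \<Rightarrow> real^'n) \<Rightarrow> real^'n \<Rightarrow> bool" where
  "hyperbolic_singularity F x0 \<longleftrightarrow> F x0 = 0 \<and>
     (\<forall>c\<in>complex_eigenvalues (jacobian F (at x0)). Re c \<noteq> 0)"

definition integral_curve ::
  "('a::real_normed_vector \<Rightarrow> 'a) \<Rightarrow> (real \<Rightarrow> 'a) \<Rightarrow> real set \<Rightarrow> bool" where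
  "integral_curve F u I \<longleftrightarrow> (\<forall>s\<in>I. (u has_vector_derivative F (u s)) (at s within I))"

text \<open>The vector field need only be regular near the singularity, so existence and uniqueness of
  the integral curve up to time \<open>t\<close> are part of the domain of the time-\<open>t\<close> map. The segment
  covers both signs of \<open>t\<close>. Outside the domain the value of \<open>flow\<close> is meaningless.\<close>

definition flow_domain :: "('a::real_normed_vector \<Rightarrow> 'a) \<Rightarrow> real \<Rightarrow> 'a set" where
  "flow_domain F t = {x.
     (\<exists>u. integral_curve F u (closed_segment 0 t) \<and> u 0 = x) \<and>
     (\<forall>u v. integral_curve F u (closed_segment 0 t) \<and> u 0 = x \<and>
            integral_curve F v (closed_segment 0 t) \<and> v 0 = x \<longrightarrow>
            (\<forall>s\<in>closed_segment 0 t. u s = v s))}"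

definition flow :: "('a::real_normed_vector \<Rightarrow> 'a) \<Rightarrow> real \<Rightarrow> 'a \<Rightarrow> 'a" where
  "flow F t x = (THE y. \<exists>u. integral_curve F u (closed_segment 0 t) \<and> u 0 = x \<and> u t = y)"

definition unit_time_map :: "('a::real_normed_vector \<Rightarrow> 'a) \<Rightarrow> 'a \<Rightarrow> 'a" where
  "unit_time_map F = flow F 1"

text \<open>As \<open>infdist y {} = 0\<close> in the library, the empty set is treated separately.\<close>

definition nbhd :: "'a::metric_space set \<Rightarrow> real \<Rightarrow> 'a set" where
  "nbhd A \<epsilon> = {y. A \<noteq> {} \<and> infdist y A < \<epsilon>}"

definition lower_content :: "real \<Rightarrow> 'a::euclidean_space set \<Rightarrow> ennreal" where
  "lower_content s A =
     Liminf (at_right 0) (\<lambda>\<epsilon>. emeasure lebesgue (nbhd A \<epsilon>) / ennreal (\<epsilon> powr (real DIM('a) - s)))"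

definition upper_content :: "real \<Rightarrow> 'a::euclidean_space set \<Rightarrow> ennreal" where
  "upper_content s A =
     Limsup (at_right 0) (\<lambda>\<epsilon>. emeasure lebesgue (nbhd A \<epsilon>) / ennreal (\<epsilon> powr (real DIM('a) - s)))"

text \<open>For bounded \<open>A\<close> both sets below contain every \<open>s > DIM('a)\<close>, so the real infima are proper.\<close>

definition lower_box_dim :: "'a::euclidean_space set \<Rightarrow> real" where
  "lower_box_dim A = Inf {s. s > 0 \<and> lower_content s A = 0}"

definition upper_box_dim :: "'a::euclidean_space set \<Rightarrow> real" where
  "upper_box_dim A = Inf {s. s > 0 \<and> upper_content s A = 0}"

definition has_box_dim :: "'a::euclidean_space set \<Rightarrow> real \<Rightarrow> bool" where
  "has_box_dim A d \<longleftrightarrow> bounded A \<and> lower_box_dim A = d \<and> upper_box_dim A = d"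

end

theory Submission
  imports Defs "HOL-Computational_Algebra.Fundamental_Theorem_Algebra" "HOL-Real_Asymp.Real_Asymp"
begin

text \<open>A polynomial annihilating \<open>DF(0)\<close>, split into linear factors, yields a quadratic Lyapunov form for
  the linear part without any normal form theory. By \<open>C\<^sup>1\<close> regularity it is also a strict Lyapunov form
  for \<open>F\<close> near \<open>0\<close>; this confines all integral curves starting close to \<open>0\<close> to a ball on which \<open>F\<close> is
  Lipschitz, so that they exist uniquely up to time \<open>1\<close>, and it makes the orbit of the unit-time map
  converge to \<open>0\<close> geometrically. A geometrically convergent sequence has an \<open>\<epsilon>\<close>-neighbourhood of volume
  \<open>O(\<epsilon>\<^sup>n log (1/\<epsilon>))\<close>, hence box dimension \<open>0\<close>.\<close>

subsection \<open>Lyapunov forms of stable matrices\<close>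

lemma bounded_bilinear_add:
  assumes "bounded_bilinear B" "bounded_bilinear C"
  shows "bounded_bilinear (\<lambda>x y. B x y + C x y)"
proof -
  interpret B: bounded_bilinear B by fact
  interpret C: bounded_bilinear C by fact
  obtain K L where KL: "\<And>x y. norm (B x y) \<le> norm x * norm y * K"
    "\<And>x y. norm (C x y) \<le> norm x * norm y * L"
    using B.bounded C.bounded by blast
  have "norm (B x y + C x y) \<le> norm x * norm y * (K + L)" for x y
    using norm_triangle_ineq[of "B x y" "C x y"] KL[of x y] by (simp add: distrib_left)
  then show ?thesis
    by unfold_locales
       (auto simp: B.add_left B.add_right C.add_left C.add_right B.scaleR_left B.scaleR_right
          C.scaleR_left C.scaleR_right scaleR_add_right)
qed

text \<open>This is \<open>p(M) x\<close> in Horner form. Acting on a vector, it needs only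
  matrix-vector products, and its laws follow by induction on the coefficients.\<close>

definition poly_mv :: "'a::field^'n^'n \<Rightarrow> 'a poly \<Rightarrow> 'a^'n \<Rightarrow> 'a^'n" where
  "poly_mv M p x = fold_coeffs (\<lambda>a y. a *s x + M *v y) p 0"

lemma poly_mv_0 [simp]: "poly_mv M 0 x = 0"
  by (simp add: poly_mv_def)

lemma poly_mv_pCons [simp]: "poly_mv M (pCons a p) x = a *s x + M *v poly_mv M p x"
  unfolding poly_mv_def
  by (cases "p = 0 \<and> a = 0") (auto simp: fold_coeffs_pCons_eq)

lemma poly_mv_add: "poly_mv M (p + q) x = poly_mv M p x + poly_mv M q x"
  by (induction p q rule: poly_induct2)
     (simp_all add: matrix_vector_right_distrib vector_sadd_rdistrib)

lemma poly_mv_smult: "poly_mv M (smult c p) x = c *s poly_mv M p x"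
  by (induction p)
     (simp_all add: vector_add_ldistrib vector_scalar_commute vector_smult_assoc)

lemma poly_mv_diff: "poly_mv M (p - q) x = poly_mv M p x - poly_mv M q x"
  using poly_mv_add[of M "p - q" q x] by simp

lemma poly_mv_monom_Suc: "poly_mv M (monom 1 (Suc k)) x = M *v poly_mv M (monom 1 k) x"
  by (simp add: monom_Suc)

lemma poly_mv_vec_add: "poly_mv M p (x + y) = poly_mv M p x + poly_mv M p y"
  by (induction p) (simp_all add: matrix_vector_right_distrib vector_add_ldistrib)

lemma poly_mv_vec_scaleR:
  fixes M :: "complex^'n^'n"
  shows "poly_mv M p (c *\<^sub>R x) = c *\<^sub>R poly_mv M p x"
proof -
  have "a *s (c *\<^sub>R y) = c *\<^sub>R (a *s y)" for a and y :: "complex^'n"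
    by (simp add: vec_eq_iff)
  moreover have "M *v (c *\<^sub>R y) = c *\<^sub>R (M *v y)" for y
    using linear_scale[OF matrix_vector_mul_linear[of M]] .
  ultimately show ?thesis
    by (induction p) (simp_all add: scaleR_add_right)
qed

lemma bounded_linear_poly_mv:
  fixes M :: "complex^'n^'n"
  shows "bounded_linear (poly_mv M p)"
  by (intro linear_conv_bounded_linear[THEN iffD1] linearI poly_mv_vec_add poly_mv_vec_scaleR)

lemma poly_mv_mult_vec: "poly_mv M p (M *v x) = M *v poly_mv M p x"
  by (induction p) (simp_all add: matrix_vector_right_distrib vector_scalar_commute)

lemma poly_mv_linear_factor: "poly_mv M ([:- c, 1:] * q) x = M *v poly_mv M q x - c *s poly_mv M q x"
proof -
  have "[:- c, 1:] * q = pCons 0 q - smult c q" by simp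
  then show ?thesis by (simp only: poly_mv_diff poly_mv_smult poly_mv_pCons) simp
qed

text \<open>The powers of \<open>M\<close> lie in a finite-dimensional real vector space, so some
  power is a combination of lower ones. Subtracting that combination leaves a monic polynomial that
  kills every vector.\<close>

lemma exists_annihilating_poly:
  fixes M :: "complex^'n^'n"
  shows "\<exists>p. p \<noteq> 0 \<and> (\<forall>x. poly_mv M p x = 0)"
proof -
  define pw where "pw k = (((**) M) ^^ k) (mat 1)" for k :: nat
  have pw: "pw k *v x = poly_mv M (monom 1 k) x" for k x
  proof (induction k)
    case 0
    then show ?case by (simp add: pw_def monom_0)
  next
    case (Suc k)
    have "pw (Suc k) = M ** pw k" by (simp add: pw_def)
    then show ?case using Suc by (simp add: poly_mv_monom_Suc flip: matrix_vector_mul_assoc)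
  qed
  have "\<exists>m. pw m \<in> span (pw ` {..<m})"
  proof (rule ccontr)
    assume H: "\<not> ?thesis"
    have "independent (pw ` {..<m}) \<and> card (pw ` {..<m}) = m" for m
    proof (induction m)
      case 0
      then show ?case by (simp add: independent_empty)
    next
      case (Suc m)
      have "pw m \<notin> pw ` {..<m}" using H span_base by metis
      then show ?case using Suc independent_insertI[of "pw m" "pw ` {..<m}"] H by (simp add: lessThan_Suc)
    qed
    from this[of "Suc DIM(complex^'n^'n)"] independent_bound show False by fastforce
  qed
  then obtain m where m: "pw m \<in> span (pw ` {..<m})" by blast
  \<comment> \<open>\<open>S\<close> holds the matrices that act as polynomials in \<open>M\<close>
    of degree below \<open>m\<close>. It is a real subspace containing the lower powers, hence their
    span and \<open>pw m\<close>. The degree bound later gives \<open>monom 1 m - p\<close> the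
    coefficient 1 at \<open>m\<close>, so that it is nonzero.\<close>
  define S where "S = {P. \<exists>p. (\<forall>k\<ge>m. coeff p k = 0) \<and> (\<forall>x. P *v x = poly_mv M p x)}"
  have "subspace S"
    unfolding subspace_def
  proof (intro conjI ballI allI)
    show "0 \<in> S" unfolding S_def by (auto intro!: exI[of _ 0])
  next
    fix P Q assume "P \<in> S" "Q \<in> S"
    then obtain p q where "\<forall>k\<ge>m. coeff p k = 0" "\<forall>x. P *v x = poly_mv M p x"
      "\<forall>k\<ge>m. coeff q k = 0" "\<forall>x. Q *v x = poly_mv M q x" unfolding S_def by auto
    then show "P + Q \<in> S" unfolding S_def
      by (auto intro!: exI[of _ "p + q"] simp: poly_mv_add matrix_vector_mult_add_rdistrib)
  next
    fix c :: real and P assume "P \<in> S"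
    then obtain p where "\<forall>k\<ge>m. coeff p k = 0" "\<forall>x. P *v x = poly_mv M p x"
      unfolding S_def by auto
    moreover have "(c *\<^sub>R P) *v x = of_real c *s (P *v x)" for x
      unfolding vec_eq_iff matrix_vector_mult_def
      by (simp add: sum_distrib_left mult.assoc) (simp add: scaleR_conv_of_real mult.assoc)
    ultimately show "c *\<^sub>R P \<in> S" unfolding S_def
      by (auto intro!: exI[of _ "smult (of_real c) p"] simp: poly_mv_smult)
  qed
  moreover have "pw ` {..<m} \<subseteq> S" unfolding S_def using pw by (auto intro!: exI[of _ "monom 1 _"])
  ultimately have "pw m \<in> S" using m span_minimal by blast
  then obtain p where p: "\<forall>k\<ge>m. coeff p k = 0" "\<forall>x. pw m *v x = poly_mv M p x"
    unfolding S_def by auto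
  have "coeff (monom 1 m - p) m = 1" using p by simp
  then have "monom 1 m - p \<noteq> 0" by fastforce
  moreover have "poly_mv M (monom 1 m - p) x = 0" for x
    using p(2) pw by (simp add: poly_mv_diff)
  ultimately show ?thesis by blast
qed

text \<open>Take \<open>p\<close> of least degree. For a root \<open>c\<close> the cofactor
  \<open>q\<close> has smaller degree, so \<open>q(M) x\<close> is nonzero for some
  \<open>x\<close>; as \<open>(M - c) q(M) x = p(M) x = 0\<close>, this vector is an eigenvector for
  \<open>c\<close>.\<close>

lemma exists_annihilating_poly_eigenvalues:
  fixes M :: "complex^'n^'n"
  obtains p where "p \<noteq> 0" "\<And>x. poly_mv M p x = 0"
    "\<And>c. poly p c = 0 \<Longrightarrow> \<exists>v. v \<noteq> 0 \<and> M *v v = c *s v"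
proof -
  let ?P = "\<lambda>p. p \<noteq> 0 \<and> (\<forall>x. poly_mv M p x = 0)"
  obtain p where p: "?P p" and min: "\<And>q. ?P q \<Longrightarrow> degree p \<le> degree q"
    using exists_annihilating_poly[of M] ex_has_least_nat[of ?P _ degree] by blast
  have "\<exists>v. v \<noteq> 0 \<and> M *v v = c *s v" if root: "poly p c = 0" for c
  proof -
    from root obtain q where q: "p = [:- c, 1:] * q" by (auto simp: poly_eq_0_iff_dvd)
    have "q \<noteq> 0" using p q by auto
    then have "degree q < degree p" unfolding q by (subst degree_mult_eq) auto
    with min[of q] \<open>q \<noteq> 0\<close> obtain x where x: "poly_mv M q x \<noteq> 0" by fastforce
    have "M *v poly_mv M q x = c *s poly_mv M q x"
      using p poly_mv_linear_factor[of M c q x] q by simp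
    with x show ?thesis by blast
  qed
  with p that show ?thesis by blast
qed

text \<open>Peeling off a root \<open>c\<close>, \<open>w = q(M) x\<close> satisfies \<open>w' = c w + p(M) x\<close> along \<open>x' = M x\<close>, so a large
  multiple of \<open>|w|\<^sup>2\<close> absorbs the error term of the form constructed for \<open>q\<close>.\<close>

lemma lyapunov_form_up_to_poly:
  fixes M :: "complex^'n^'n"
  assumes "a > 0" "p \<noteq> 0" "\<And>c. poly p c = 0 \<Longrightarrow> Re c \<le> - a"
  shows "\<exists>B K. bounded_bilinear B \<and> (\<forall>x y. B x y = B y x) \<and> K \<ge> 0 \<and>
    (\<forall>x. (norm x)\<^sup>2 \<le> B x x \<and> B x (M *v x) \<le> - (a/4) * B x x + K * (norm (poly_mv M p x))\<^sup>2)"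
  using assms(2,3)
proof (induction "degree p" arbitrary: p)
  case 0
  then obtain c where c: "p = [:c:]" "c \<noteq> 0" by (metis degree_eq_zeroE pCons_0_0)
  obtain K where K: "K > 0" "\<And>x. norm (M *v x) \<le> norm x * K"
    using bounded_linear.pos_bounded[OF matrix_vector_mul_bounded_linear[of M]] by blast
  have "inner x (M *v x) \<le> - (a/4) * inner x x + ((K + a/4) / (norm c)\<^sup>2) * (norm (poly_mv M p x))\<^sup>2"
    for x
  proof -
    have "inner x (M *v x) \<le> norm x * (norm x * K)"
      by (rule order_trans[OF norm_cauchy_schwarz mult_left_mono[OF K(2)]]) simp
    moreover have "norm (c *s x) = norm c * norm x"
      unfolding norm_vec_def by (simp add: norm_mult L2_set_right_distrib)
    then have "(norm (poly_mv M p x))\<^sup>2 = (norm c)\<^sup>2 * (norm x)\<^sup>2"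
      by (simp add: c power_mult_distrib)
    ultimately have "inner x (M *v x) \<le> K * (norm x)\<^sup>2"
      and "((K + a/4) / (norm c)\<^sup>2) * (norm (poly_mv M p x))\<^sup>2 = K * (norm x)\<^sup>2 + a/4 * (norm x)\<^sup>2"
      using c(2) by (simp_all add: power2_eq_square field_simps)
    then show ?thesis by (simp add: power2_norm_eq_inner)
  qed
  moreover have "(K + a/4) / (norm c)\<^sup>2 \<ge> 0" using K(1) assms(1) by simp
  ultimately show ?case
    using bounded_bilinear_inner
    by (intro exI[of _ inner] exI[of _ "(K + a/4) / (norm c)\<^sup>2"])
       (auto simp: inner_commute power2_norm_eq_inner)
next
  case (Suc d)
  obtain c where root: "poly p c = 0"
    using fundamental_theorem_of_algebra_alt[of p] Suc.hyps(2) by fastforce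
  then obtain q where q: "p = [:- c, 1:] * q" by (auto simp: poly_eq_0_iff_dvd)
  have "q \<noteq> 0" using Suc.prems q by auto
  then have "degree p = Suc (degree q)" unfolding q by (subst degree_mult_eq) auto
  then have "d = degree q" using Suc.hyps(2) by simp
  moreover have "Re z \<le> - a" if "poly q z = 0" for z using Suc.prems(2)[of z] that q by simp
  ultimately obtain B K where B: "bounded_bilinear B" "\<And>x y. B x y = B y x" "K \<ge> 0"
    "\<And>x. (norm x)\<^sup>2 \<le> B x x"
    "\<And>x. B x (M *v x) \<le> - (a/4) * B x x + K * (norm (poly_mv M q x))\<^sup>2"
    using Suc.hyps(1)[of q] \<open>q \<noteq> 0\<close> by metis
  \<comment> \<open>With \<open>C * a = 4 * K\<close>, the new term contributes
    \<open>- 2 * K\<close> times the squared norm of \<open>w\<close>. One half cancels the error of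
    \<open>B\<close>, and the other is exactly the decay at rate \<open>a/4\<close> required of the
    new term.\<close>
  define C where "C = 4 * K / a"
  have C: "C \<ge> 0" "C * a = 4 * K" using B(3) assms(1) by (auto simp: C_def)
  define w where "w = poly_mv M q"
  have w: "bounded_linear w" unfolding w_def by (rule bounded_linear_poly_mv)
  define B' where "B' x y = B x y + C * inner (w x) (w y)" for x y
  have "bounded_bilinear (\<lambda>x y. C * inner (w x) (w y))"
    using bounded_bilinear.comp[OF bounded_bilinear_inner bounded_linear_const_scaleR[OF w] w, of C]
    by simp
  then have "bounded_bilinear B'" unfolding B'_def
    by (intro bounded_bilinear_add B(1))
  moreover have "B' x y = B' y x" for x y by (simp add: B'_def B(2)[of x y] inner_commute)
  moreover have "(norm x)\<^sup>2 \<le> B' x x" for x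
    using B(4)[of x] C(1) by (simp add: B'_def add_increasing2)
  moreover have "B' x (M *v x) \<le> - (a/4) * B' x x + (C / (2 * a)) * (norm (poly_mv M p x))\<^sup>2" for x
  proof -
    let ?e = "poly_mv M p x"
    have Mw: "w (M *v x) = c *s w x + ?e"
      unfolding w_def q by (simp only: poly_mv_mult_vec poly_mv_linear_factor) simp
    \<comment> \<open>The real inner product on the complex numbers is the real part of the
      Hermitian one, so the imaginary part of \<open>c\<close> drops out.\<close>
    have "inner z (c * z) = Re c * inner z z" for z :: complex
      by (simp add: inner_complex_def algebra_simps power2_eq_square)
    then have "inner (w x) (c *s w x) = Re c * (norm (w x))\<^sup>2"
      by (simp add: power2_norm_eq_inner inner_vec_def sum_distrib_left)
    also have "\<dots> \<le> - a * (norm (w x))\<^sup>2"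
      using Suc.prems(2)[OF root] by (intro mult_right_mono) auto
    finally have 1: "inner (w x) (c *s w x) \<le> - a * (norm (w x))\<^sup>2" .
    \<comment> \<open>Young's inequality, weighted so that half of the decay rate \<open>a\<close>
      survives.\<close>
    have 2: "inner (w x) ?e \<le> a / 2 * (norm (w x))\<^sup>2 + (norm ?e)\<^sup>2 / (2 * a)"
    proof -
      have "0 \<le> (a * norm (w x) - norm ?e)\<^sup>2 / (2 * a)" using assms(1) by simp
      also have "\<dots> = a / 2 * (norm (w x))\<^sup>2 + (norm ?e)\<^sup>2 / (2 * a) - norm (w x) * norm ?e"
        using assms(1) by (simp add: field_simps power2_eq_square)
      finally show ?thesis using norm_cauchy_schwarz[of "w x" ?e] by linarith
    qed
    have "inner (w x) (w (M *v x)) \<le> - (a/2) * (norm (w x))\<^sup>2 + (norm ?e)\<^sup>2 / (2 * a)"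
      using 1 2 by (simp add: Mw inner_add_right)
    then have "C * inner (w x) (w (M *v x)) \<le>
        C * (- (a/2) * (norm (w x))\<^sup>2 + (norm ?e)\<^sup>2 / (2 * a))"
      using C(1) by (rule mult_left_mono)
    also have "\<dots> = - (C * a / 2) * (norm (w x))\<^sup>2 + (C / (2 * a)) * (norm ?e)\<^sup>2"
      by (simp add: algebra_simps)
    finally have 3: "C * inner (w x) (w (M *v x)) \<le> - (2 * K) * (norm (w x))\<^sup>2 + (C / (2 * a)) * (norm ?e)\<^sup>2"
      using C(2) by simp
    have 4: "- (a/4) * (C * inner (w x) (w x)) = - K * (norm (w x))\<^sup>2"
      using C(2) by (simp add: power2_norm_eq_inner field_simps)
    have "B' x (M *v x) \<le> - (a/4) * B x x + K * (norm (w x))\<^sup>2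
        + (- (2 * K) * (norm (w x))\<^sup>2 + (C / (2 * a)) * (norm ?e)\<^sup>2)"
      unfolding B'_def using B(5)[of x] 3 unfolding w_def[symmetric] by linarith
    also have "\<dots> = - (a/4) * B x x - K * (norm (w x))\<^sup>2 + (C / (2 * a)) * (norm ?e)\<^sup>2"
      by simp
    also have "\<dots> = - (a/4) * B' x x + (C / (2 * a)) * (norm ?e)\<^sup>2"
      unfolding B'_def distrib_left 4 by simp
    finally show ?thesis .
  qed
  moreover have "C / (2 * a) \<ge> 0" using C(1) assms(1) by simp
  ultimately show ?case by blast
qed

text \<open>Complexify \<open>A\<close>, use the form for an annihilating polynomial, whose error
  term vanishes, and restrict it to the real vectors, which \<open>M\<close> preserves.\<close>

lemma lyapunov_form:
  fixes A :: "real^'n^'n"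
  assumes "\<forall>c\<in>complex_eigenvalues A. Re c < 0"
  obtains B and a :: real where "bounded_bilinear B" "\<And>x y. B x y = B y x" "a > 0"
    "\<And>x. (norm x)\<^sup>2 \<le> B x x" "\<And>x. B x (A *v x) \<le> - a * B x x"
proof -
  define M where "M = (\<chi> i j. complex_of_real (A $ i $ j))"
  obtain p where p: "p \<noteq> 0" "\<And>x. poly_mv M p x = 0"
    and ev: "\<And>c. poly p c = 0 \<Longrightarrow> \<exists>v. v \<noteq> 0 \<and> M *v v = c *s v"
    using exists_annihilating_poly_eigenvalues[of M] by blast
  have neg: "Re c < 0" if "poly p c = 0" for c
    using assms ev[OF that] unfolding complex_eigenvalues_def M_def by blast
  \<comment> \<open>The gap between the roots and the imaginary axis, capped at 1; the inserted
    \<open>-1\<close> keeps the maximum over a nonempty set.\<close>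
  define a where "a = - Max (insert (-1) (Re ` {c. poly p c = 0}))"
  have fin: "finite (insert (-1) (Re ` {c. poly p c = 0}))" using poly_roots_finite[OF p(1)] by simp
  have "a > 0" unfolding a_def using neg Max_less_iff[OF fin, of 0] by auto
  moreover have "Re c \<le> - a" if "poly p c = 0" for c
    unfolding a_def minus_minus using fin that by (intro Max_ge) auto
  ultimately obtain B K where B: "bounded_bilinear B" "\<And>x y. B x y = B y x"
    "\<And>x. (norm x)\<^sup>2 \<le> B x x"
    "\<And>x. B x (M *v x) \<le> - (a/4) * B x x + K * (norm (poly_mv M p x))\<^sup>2"
    using lyapunov_form_up_to_poly[of a p M] p(1) by metis
  define cx :: "real^'n \<Rightarrow> complex^'n" where "cx x = (\<chi> i. complex_of_real (x $ i))" for x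
  have cx: "bounded_linear cx"
    by (intro linear_conv_bounded_linear[THEN iffD1] linearI)
       (simp_all add: cx_def vec_eq_iff complex_eq_iff)
  have norm: "norm (cx x) = norm x" for x by (simp add: cx_def norm_vec_def)
  have M: "cx (A *v x) = M *v cx x" for x
    by (simp add: cx_def M_def vec_eq_iff matrix_vector_mult_def)
  show ?thesis
  proof (rule that[of "\<lambda>x y. B (cx x) (cx y)" "a/4"])
    show "bounded_bilinear (\<lambda>x y. B (cx x) (cx y))" by (rule bounded_bilinear.comp[OF B(1) cx cx])
    show "a / 4 > 0" using \<open>a > 0\<close> by simp
    show "(norm x)\<^sup>2 \<le> B (cx x) (cx x)" for x using B(3)[of "cx x"] norm by simp
    show "B (cx x) (cx (A *v x)) \<le> - (a / 4) * B (cx x) (cx x)" for x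
      using B(4)[of "cx x"] p(2) by (simp add: M)
  qed (rule B(2))
qed

subsection \<open>Integral curves near a stable singularity\<close>

lemma integral_curve_continuous_on:
  "integral_curve F u I \<Longrightarrow> continuous_on I u"
  unfolding integral_curve_def by (meson continuous_on_vector_derivative)

lemma integral_curve_at:
  assumes "integral_curve F u {a..b}" "a < t" "t < b"
  shows "(u has_vector_derivative F (u t)) (at t)"
  using assms unfolding integral_curve_def by (metis at_within_Icc_at atLeastAtMost_iff less_imp_le)

text \<open>As long as the curve stays in the ball, \<open>exp (2 * a * s) * B (u s) (u s)\<close>
  does not increase. It cannot leave: at a first time with norm at least \<open>R\<close>, the value
  of \<open>B\<close> would be at least \<open>R\<^sup>2\<close>, although it started below
  \<open>R\<^sup>2\<close> and has not grown.\<close>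

lemma lyapunov_decay:
  fixes G :: "'a::real_normed_vector \<Rightarrow> 'a"
  assumes B: "bounded_bilinear B" "\<And>x y. B x y = B y x" "\<And>x. (norm x)\<^sup>2 \<le> B x x"
    and G: "\<And>x. norm x \<le> R \<Longrightarrow> B x (G x) \<le> - a * B x x"
    and u: "integral_curve G u {0..T}" and "a \<ge> 0" and u0: "B (u 0) (u 0) < R\<^sup>2" and "R > 0"
    and t: "t \<in> {0..T}"
  shows "norm (u t) < R" "B (u t) (u t) \<le> exp (- 2 * a * t) * B (u 0) (u 0)"
proof -
  interpret bounded_bilinear B by fact
  have contu: "continuous_on {0..T} u" using integral_curve_continuous_on[OF u] .
  define f where "f s = exp (2 * a * s) * B (u s) (u s)" for s
  \<comment> \<open>The bound on the norm is assumed only strictly before \<open>t\<close>, so this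
    applies at the first exit time itself.\<close>
  have step: "B (u t) (u t) \<le> exp (- 2 * a * t) * B (u 0) (u 0)"
    if t: "t \<in> {0..T}" and le: "\<And>s. 0 < s \<Longrightarrow> s < t \<Longrightarrow> norm (u s) \<le> R" for t
  proof -
    have "f t \<le> f 0"
    proof (rule DERIV_nonpos_imp_decreasing_open[where f = f])
      show "0 \<le> t" using t by simp
      show "continuous_on {0..t} f" unfolding f_def
        using t by (intro continuous_intros continuous_on continuous_on_subset[OF contu]) auto
      fix s assume s: "0 < s" "s < t"
      have du: "(u has_vector_derivative G (u s)) (at s)"
        using integral_curve_at[OF u s(1)] s t by simp
      have "((\<lambda>s. B (u s) (u s)) has_real_derivative (B (u s) (G (u s)) + B (G (u s)) (u s))) (at s)"
        unfolding has_real_derivative_iff_has_vector_derivative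
        by (rule has_vector_derivative[OF du du])
      then have "(f has_real_derivative
          exp (2 * a * s) * (2 * B (u s) (G (u s)) + 2 * a * B (u s) (u s))) (at s)"
        unfolding f_def
        by (auto intro!: derivative_eq_intros simp: B(2)[of "G (u s)"] algebra_simps)
      moreover have "2 * B (u s) (G (u s)) + 2 * a * B (u s) (u s) \<le> 0"
        using G[OF le[OF s]] by simp
      ultimately show "\<exists>y. (f has_real_derivative y) (at s) \<and> y \<le> 0"
        by (meson exp_ge_zero mult_nonneg_nonpos)
    qed
    then show ?thesis by (simp add: f_def exp_minus field_simps)
  qed
  have lt: "norm (u s) < R" if s: "s \<in> {0..T}" for s
  proof (rule ccontr)
    assume "\<not> norm (u s) < R"
    define S where "S = {s \<in> {0..T}. R \<le> norm (u s)}"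
    have "S \<noteq> {}" using s \<open>\<not> norm (u s) < R\<close> by (auto simp: S_def)
    have "closed S" unfolding S_def
      by (intro continuous_on_closed_Collect_le continuous_intros contu)
    moreover have bdd: "bdd_below S" unfolding S_def by (auto intro: bdd_belowI[of _ 0])
    ultimately have "Inf S \<in> S" using \<open>S \<noteq> {}\<close> closed_contains_Inf by blast
    then have I: "Inf S \<in> {0..T}" "R \<le> norm (u (Inf S))" by (auto simp: S_def)
    have "norm (u r) \<le> R" if "0 < r" "r < Inf S" for r
    proof (rule ccontr)
      assume "\<not> ?thesis"
      then have "r \<in> S" using that I by (auto simp: S_def)
      then show False using cInf_lower[OF _ bdd] that by fastforce
    qed
    from step[OF I(1) this] have "B (u (Inf S)) (u (Inf S)) \<le> exp (- 2 * a * Inf S) * B (u 0) (u 0)" .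
    also have "\<dots> \<le> 1 * B (u 0) (u 0)"
      using I(1) \<open>a \<ge> 0\<close> B(3)[of "u 0"] order_trans[OF zero_le_power2]
      by (intro mult_right_mono) auto
    also have "\<dots> < R\<^sup>2" using u0 by simp
    finally have "(norm (u (Inf S)))\<^sup>2 < R\<^sup>2" using B(3) le_less_trans by blast
    then show False using I(2) power_less_imp_less_base[of "norm (u (Inf S))" 2 R] \<open>R > 0\<close> by simp
  qed
  show "norm (u t) < R" using lt t .
  show "B (u t) (u t) \<le> exp (- 2 * a * t) * B (u 0) (u 0)"
    using t by (intro step less_imp_le[OF lt]) auto
qed

text \<open>A Gronwall argument: the squared distance of the curves, damped by
  \<open>exp (- 2 * L * s)\<close>, does not increase and starts at 0. Squaring makes the distance
  differentiable where the curves meet.\<close>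

lemma integral_curve_unique:
  fixes F :: "'a::real_inner \<Rightarrow> 'a"
  assumes u: "integral_curve F u {0..T}" "\<And>t. t \<in> {0..T} \<Longrightarrow> u t \<in> S"
    and v: "integral_curve F v {0..T}" "\<And>t. t \<in> {0..T} \<Longrightarrow> v t \<in> S"
    and lip: "\<And>x y. x \<in> S \<Longrightarrow> y \<in> S \<Longrightarrow> norm (F x - F y) \<le> L * norm (x - y)"
    and "u 0 = v 0" and t: "t \<in> {0..T}"
  shows "u t = v t"
proof -
  define f where "f s = exp (- 2 * L * s) * (inner (u s - v s) (u s - v s))" for s
  have "f t \<le> f 0"
  proof (rule DERIV_nonpos_imp_decreasing_open[where f = f])
    show "0 \<le> t" using t by simp
    show "continuous_on {0..t} f" unfolding f_def
      using t u v by (intro continuous_intros continuous_on_subset[OF integral_curve_continuous_on]) auto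
    fix s assume s: "0 < s" "s < t"
    let ?d = "u s - v s" and ?d' = "F (u s) - F (v s)"
    have d: "((\<lambda>s. u s - v s) has_vector_derivative ?d') (at s)"
      using s t by (intro has_vector_derivative_diff integral_curve_at[OF u(1)] integral_curve_at[OF v(1)]) auto
    have "((\<lambda>s. inner (u s - v s) (u s - v s)) has_real_derivative (inner ?d ?d' + inner ?d' ?d)) (at s)"
      unfolding has_real_derivative_iff_has_vector_derivative
      by (rule bounded_bilinear.has_vector_derivative[OF bounded_bilinear_inner d d])
    moreover have "((\<lambda>s. exp (- 2 * L * s)) has_real_derivative - 2 * L * exp (- 2 * L * s)) (at s)"
      by (auto intro!: derivative_eq_intros)
    ultimately have "(f has_real_derivative - 2 * L * exp (- 2 * L * s) * inner ?d ?d
        + (inner ?d ?d' + inner ?d' ?d) * exp (- 2 * L * s)) (at s)"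
      unfolding f_def by (intro DERIV_mult)
    also have "- 2 * L * exp (- 2 * L * s) * inner ?d ?d + (inner ?d ?d' + inner ?d' ?d) * exp (- 2 * L * s)
        = exp (- 2 * L * s) * (2 * inner ?d ?d' - 2 * L * inner ?d ?d)"
      unfolding inner_commute[of ?d' ?d] by algebra
    finally have "(f has_real_derivative exp (- 2 * L * s) * (2 * inner ?d ?d' - 2 * L * inner ?d ?d)) (at s)" .
    moreover have "inner ?d ?d' \<le> norm ?d * (L * norm ?d)"
      using s t u(2) v(2) by (intro order_trans[OF norm_cauchy_schwarz] mult_left_mono lip) auto
    then have "2 * inner ?d ?d' - 2 * L * inner ?d ?d \<le> 0"
      by (simp add: power2_norm_eq_inner[symmetric] power2_eq_square algebra_simps)
    ultimately show "\<exists>y. (f has_real_derivative y) (at s) \<and> y \<le> 0"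
      by (meson exp_ge_zero mult_nonneg_nonpos)
  qed
  also have "f 0 = 0" using \<open>u 0 = v 0\<close> by (simp add: f_def)
  finally have "inner (u t - v t) (u t - v t) \<le> 0" by (simp add: f_def mult_le_0_iff)
  then show ?thesis by (metis inner_ge_zero inner_eq_zero_iff order_antisym right_minus_eq)
qed

text \<open>Picard iteration for \<open>v t = e\<^sup>-\<^sup>2\<^sup>L\<^sup>t (u t - x)\<close>: in this variable it contracts by \<open>1/2\<close> on the
  whole interval, so no concatenation of short-time solutions is needed.\<close>

lemma integral_curve_exists:
  fixes G :: "'a::euclidean_space \<Rightarrow> 'a"
  assumes "L > 0" "T \<ge> 0" and lip: "\<And>x y. norm (G x - G y) \<le> L * norm (x - y)"
  shows "\<exists>u. integral_curve G u {0..T} \<and> u 0 = x"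
proof -
  have "L-lipschitz_on UNIV G"
    using assms by (intro lipschitz_onI) (auto simp: dist_norm)
  then have contG: "continuous_on S G" for S
    using lipschitz_on_continuous_on continuous_on_subset by blast
  \<comment> \<open>Clamping time to \<open>{0..T}\<close> turns the iterates into bounded
    continuous functions on the whole line, a complete space on which Banach's fixed point theorem
    applies.\<close>
  define c where "c t = max 0 (min T t)" for t
  have c: "c t \<in> {0..T}" "continuous_on UNIV c" for t
    using \<open>T \<ge> 0\<close> unfolding c_def by (auto intro!: continuous_intros)
  have cid: "c t = t" if "t \<in> {0..T}" for t using that by (auto simp: c_def)
  define h where "h v s = G (x + exp (2 * L * s) *\<^sub>R apply_bcontfun v s)" for v :: "real \<Rightarrow>\<^sub>C 'a" and s
  have conth: "continuous_on S (h v)" for S v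
    unfolding h_def by (intro continuous_on_compose2[OF contG[of UNIV]] continuous_intros) auto
  define I where "I v t = exp (- 2 * L * t) *\<^sub>R integral {0..t} (h v)" for v t
  have contI: "continuous_on {0..T} (I v)" for v
    unfolding I_def
    by (intro continuous_intros indefinite_integral_continuous_1 integrable_continuous_real conth)
  have I_bcontfun: "(\<lambda>t. I v (c t)) \<in> bcontfun" for v
  proof -
    have "continuous_on UNIV (\<lambda>t. I v (c t))"
      using c by (intro continuous_on_compose2[OF contI]) auto
    moreover have "bounded (range (\<lambda>t. I v (c t)))"
      using c by (intro bounded_subset[OF compact_imp_bounded[OF compact_continuous_image[OF contI]]]) auto
    ultimately show ?thesis by (simp add: bcontfun_def)
  qed
  define \<Phi> where "\<Phi> v = Bcontfun (\<lambda>t. I v (c t))" for v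
  have \<Phi>: "apply_bcontfun (\<Phi> v) t = I v (c t)" for v t
    by (simp add: \<Phi>_def Bcontfun_inverse[OF I_bcontfun])
  have "dist (\<Phi> v) (\<Phi> w) \<le> 1/2 * dist v w" for v w
  proof (rule dist_bound)
    fix t
    define \<tau> where "\<tau> = c t"
    have \<tau>: "\<tau> \<ge> 0" using c(1)[of t] by (simp add: \<tau>_def)
    \<comment> \<open>The factor \<open>exp (2 * L * s)\<close> in \<open>h\<close> enters this
      bound. Its integral is at most \<open>exp (2 * L * \<tau>) / 2 * dist v w\<close>, and the
      damping factor in \<open>I\<close> reduces that to half of \<open>dist v w\<close>.\<close>
    let ?g = "\<lambda>s. L * exp (2 * L * s) * dist v w"
    have hi: "(?g has_integral (exp (2 * L * \<tau>) / 2 * dist v w - exp (2 * L * 0) / 2 * dist v w)) {0..\<tau>}"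
      using \<tau> \<open>L > 0\<close>
      by (intro fundamental_theorem_of_calculus)
         (auto simp flip: has_real_derivative_iff_has_vector_derivative intro!: derivative_eq_intros)
    have hb: "norm (h v s - h w s) \<le> ?g s" for s
    proof -
      have "norm (h v s - h w s) \<le> L * norm (exp (2 * L * s) *\<^sub>R (v s - w s))"
        unfolding h_def using lip[of "x + exp (2 * L * s) *\<^sub>R v s" "x + exp (2 * L * s) *\<^sub>R w s"]
        by (simp add: scaleR_diff_right)
      also have "\<dots> \<le> L * (exp (2 * L * s) * dist v w)"
        using \<open>L > 0\<close> dist_bounded[of v s w] by (simp add: dist_norm)
      finally show ?thesis by (simp add: mult.assoc)
    qed
    have hint: "h v integrable_on {0..\<tau>}" for v by (intro integrable_continuous_real conth)
    have "norm (integral {0..\<tau>} (\<lambda>s. h v s - h w s)) \<le> integral {0..\<tau>} ?g"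
      by (intro integral_norm_bound_integral integrable_diff hint has_integral_integrable[OF hi] hb)
    also have "\<dots> = (exp (2 * L * \<tau>) - 1) / 2 * dist v w"
      using integral_unique[OF hi] by (simp add: algebra_simps)
    also have "\<dots> \<le> exp (2 * L * \<tau>) / 2 * dist v w" by (intro mult_right_mono) auto
    finally have *: "norm (integral {0..\<tau>} (\<lambda>s. h v s - h w s)) \<le> exp (2 * L * \<tau>) / 2 * dist v w" .
    have "dist (\<Phi> v t) (\<Phi> w t) = exp (- 2 * L * \<tau>) * norm (integral {0..\<tau>} (\<lambda>s. h v s - h w s))"
      unfolding \<Phi> I_def dist_norm \<tau>_def[symmetric]
      by (simp add: integral_diff[OF hint hint] flip: scaleR_diff_right)
    also have "\<dots> \<le> exp (- 2 * L * \<tau>) * (exp (2 * L * \<tau>) / 2 * dist v w)"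
      using * by (intro mult_left_mono) auto
    also have "\<dots> = 1/2 * dist v w" by (simp add: exp_minus field_simps)
    finally show "dist (\<Phi> v t) (\<Phi> w t) \<le> 1/2 * dist v w" .
  qed
  then obtain v where v: "\<Phi> v = v" using banach_fix_type[of "1/2" \<Phi>] by auto
  define u where "u t = x + integral {0..t} (h v)" for t
  have hu: "h v t = G (u t)" if "t \<in> {0..T}" for t
  proof -
    have "v t = I v t" using v \<Phi>[of v t] cid[OF that] by simp
    then have "exp (2 * L * t) *\<^sub>R v t = integral {0..t} (h v)"
      unfolding I_def by (simp add: exp_minus)
    then show ?thesis by (simp add: h_def u_def)
  qed
  have "(u has_vector_derivative G (u t)) (at t within {0..T})" if "t \<in> {0..T}" for t
    unfolding hu[OF that, symmetric] unfolding u_def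
    using has_vector_derivative_add[OF has_vector_derivative_const
        integral_has_vector_derivative[OF conth that]] by simp
  then have "integral_curve G u {0..T}" by (simp add: integral_curve_def)
  moreover have "u 0 = x" by (simp add: u_def)
  ultimately show ?thesis by blast
qed

section \<open>Uniform linearization of continuously differentiable maps\<close>

lemma Ck_on_continuous_on: "Ck_on k f U \<Longrightarrow> continuous_on U f"
  by (cases k) (auto intro: continuous_at_imp_continuous_on differentiable_imp_continuous_within)

text \<open>The mean value inequality for \<open>F\<close> minus its derivative at \<open>p\<close>:
  the derivative of this difference is small on a small ball. Comparing two arbitrary points of the
  ball yields both the Lyapunov estimate and the Lipschitz bound for \<open>F\<close>.\<close>

lemma C1_linearization:
  fixes F :: "'a::euclidean_space \<Rightarrow> 'b::real_normed_vector"
  assumes "r \<ge> 1" "Ck_near r F p" "\<delta> > 0"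
  obtains R where "R > 0"
    "\<And>x y. dist p x \<le> R \<Longrightarrow> dist p y \<le> R \<Longrightarrow>
       norm (F x - F y - frechet_derivative F (at p) (x - y)) \<le> \<delta> * norm (x - y)"
proof -
  obtain k where r: "r = Suc k" using assms(1) by (cases r) auto
  obtain U where U: "open U" "p \<in> U" "Ck_on (Suc k) F U" using assms(2) r by (auto simp: Ck_near_def)
  let ?D = "\<lambda>x. frechet_derivative F (at x)"
  have diff: "(F has_derivative ?D x) (at x)" if "x \<in> U" for x
    using U(3) that by (simp add: frechet_derivative_works)
  \<comment> \<open>This sum bounds the operator norm of the difference of the derivatives, and its
    continuity follows from that of the partial derivatives.\<close>
  define N where "N x = (\<Sum>b\<in>Basis. norm (?D x b - ?D p b))" for x
  have "continuous_on U (\<lambda>x. ?D x b)" if "b \<in> Basis" for b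
    using U(3) that by (auto intro: Ck_on_continuous_on)
  then have "continuous_on U N" unfolding N_def by (intro continuous_intros)
  then have "(N \<longlongrightarrow> N p) (at p)"
    using U continuous_on_interior continuous_at interior_open isContD by metis
  moreover have "N p = 0" by (simp add: N_def)
  ultimately have "\<forall>\<^sub>F x in at p. N x < \<delta>" using assms(3) by (simp add: order_tendstoD)
  then have "\<forall>\<^sub>F x in nhds p. N x < \<delta>" using \<open>N p = 0\<close> assms(3) by (simp add: eventually_nhds_conv_at)
  moreover have "\<forall>\<^sub>F x in nhds p. x \<in> U" using U by (intro eventually_nhds_in_open)
  ultimately have "\<forall>\<^sub>F x in nhds p. N x < \<delta> \<and> x \<in> U" by (rule eventually_conj)
  then obtain d where d: "d > 0" "\<And>x. dist x p < d \<Longrightarrow> N x < \<delta> \<and> x \<in> U"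
    unfolding eventually_nhds_metric by blast
  define R where "R = d / 2"
  have in_ball: "N x < \<delta> \<and> x \<in> U" if "x \<in> cball p R" for x
    using that d by (auto simp: R_def dist_commute)
  have lin: "bounded_linear (?D p)" using diff[OF U(2)] has_derivative_bounded_linear by blast
  show ?thesis
  proof (rule that[of R])
    show "R > 0" using d by (simp add: R_def)
    fix x y assume xy: "dist p x \<le> R" "dist p y \<le> R"
    have "norm ((F x - ?D p x) - (F y - ?D p y)) \<le> \<delta> * norm (x - y)"
    proof (rule differentiable_bound[of "cball p R"])
      show "convex (cball p R)" by simp
      show "x \<in> cball p R" "y \<in> cball p R" using xy by auto
      fix z assume z: "z \<in> cball p R"
      have D: "((\<lambda>z. F z - ?D p z) has_derivative (\<lambda>h. ?D z h - ?D p h)) (at z)"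
        using in_ball[OF z] by (intro has_derivative_diff diff bounded_linear_imp_has_derivative lin) auto
      then show "((\<lambda>z. F z - ?D p z) has_derivative (\<lambda>h. ?D z h - ?D p h)) (at z within cball p R)"
        by (rule has_derivative_at_withinI)
      have "onorm (\<lambda>h. ?D z h - ?D p h) \<le> N z"
        unfolding N_def by (rule onorm_componentwise[OF has_derivative_bounded_linear[OF D]])
      then show "onorm (\<lambda>h. ?D z h - ?D p h) \<le> \<delta>" using in_ball[OF z] by simp
    qed
    then show "norm (F x - F y - ?D p (x - y)) \<le> \<delta> * norm (x - y)"
      by (simp add: linear_diff[OF bounded_linear.linear[OF lin]] algebra_simps)
  qed
qed

subsection \<open>Box dimension of geometrically convergent sequences\<close>

lemma has_box_dim_0I:
  fixes A :: "'a::euclidean_space set"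
  assumes "bounded A" "\<And>s. s > 0 \<Longrightarrow> upper_content s A = 0"
  shows "has_box_dim A 0"
proof -
  have "lower_content s A = 0" if "s > 0" for s
  proof -
    have "lower_content s A \<le> upper_content s A"
      unfolding lower_content_def upper_content_def by (intro Liminf_le_Limsup) simp
    then show ?thesis using assms(2)[OF that] by simp
  qed
  then have "{s. s > 0 \<and> lower_content s A = 0} = {0<..}" "{s. s > 0 \<and> upper_content s A = 0} = {0<..}"
    using assms(2) by auto
  then show ?thesis
    using assms(1) by (simp add: has_box_dim_def lower_box_dim_def upper_box_dim_def)
qed

text \<open>The points of index at least \<open>log\<^sub>q (\<epsilon>/C)\<close> lie in the \<open>\<epsilon>\<close>-ball around \<open>0\<close>, so the
  \<open>\<epsilon>\<close>-neighbourhood is covered by \<open>O(log (1/\<epsilon>))\<close> balls of radius \<open>2\<epsilon>\<close>.\<close>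

lemma has_box_dim_geometric:
  fixes x :: "nat \<Rightarrow> 'a::euclidean_space"
  assumes q: "0 < q" "q < 1" and "C > 0" and x: "\<And>k. k \<ge> 1 \<Longrightarrow> norm (x k) \<le> C * q ^ k"
  shows "has_box_dim (x ` {1..}) 0"
proof (rule has_box_dim_0I)
  let ?A = "x ` {1..}" and ?n = "DIM('a)"
  have "C * q ^ k \<le> C" for k using q \<open>C > 0\<close> by (simp add: power_le_one)
  then show "bounded ?A" using x by (intro boundedI[of _ C]) (auto intro: order_trans)
  fix s :: real assume "s > 0"
  define V where "V = unit_ball_vol (real ?n) * 2 ^ ?n"
  have "V \<ge> 0" by (simp add: V_def)
  \<comment> \<open>The covering uses \<open>N + 1\<close> balls of radius
    \<open>2 * \<epsilon>\<close> with \<open>N\<close> at most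
    \<open>ln (\<epsilon> / C) / ln q + 1\<close>; each has volume
    \<open>V * \<epsilon> ^ ?n\<close>.\<close>
  define g where "g \<epsilon> = (ln (\<epsilon> / C) / ln q + 2) * V * \<epsilon> powr s" for \<epsilon>
  have bound: "emeasure lebesgue (nbhd ?A \<epsilon>) / ennreal (\<epsilon> powr (real ?n - s)) \<le> ennreal (g \<epsilon>)"
    if \<epsilon>: "0 < \<epsilon>" "\<epsilon> < C" for \<epsilon>
  proof -
    define N where "N = nat \<lceil>ln (\<epsilon> / C) / ln q\<rceil>"
    have "ln (\<epsilon> / C) < 0" "ln q < 0" using \<epsilon> q by auto
    then have pos: "ln (\<epsilon> / C) / ln q > 0" by (simp add: divide_neg_neg)
    then have N: "real N \<le> ln (\<epsilon> / C) / ln q + 1" unfolding N_def by linarith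
    have tail: "norm (x k) \<le> \<epsilon>" if k: "k \<ge> N" "k \<ge> 1" for k
    proof -
      have "ln (\<epsilon> / C) / ln q \<le> real k" using k(1) unfolding N_def by linarith
      then have "real k * ln q \<le> ln (\<epsilon> / C)" using \<open>ln q < 0\<close> by (simp add: field_simps)
      then have "ln (q ^ k) \<le> ln (\<epsilon> / C)" using q by (simp add: ln_realpow)
      then have "q ^ k \<le> \<epsilon> / C" using q \<epsilon> \<open>C > 0\<close> by (subst (asm) ln_le_cancel_iff) auto
      then have "C * q ^ k \<le> \<epsilon>" using \<open>C > 0\<close> by (simp add: field_simps)
      then show ?thesis using x[OF k(2)] by simp
    qed
    define c where "c k = (if k < N then x k else 0)" for k
    have "nbhd ?A \<epsilon> \<subseteq> (\<Union>k\<in>{..N}. ball (c k) (2 * \<epsilon>))"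
    proof
      fix y assume "y \<in> nbhd ?A \<epsilon>"
      then have "infdist y ?A < \<epsilon>" by (simp add: nbhd_def)
      then obtain k where k: "k \<ge> 1" "dist y (x k) < \<epsilon>"
        by (auto simp: infdist_def cINF_less_iff bdd_below_image_dist)
      show "y \<in> (\<Union>k\<in>{..N}. ball (c k) (2 * \<epsilon>))"
      proof (cases "k < N")
        case True
        then show ?thesis using k \<epsilon> by (auto simp: c_def dist_commute intro!: bexI[of _ k])
      next
        case False
        then have "dist y 0 < 2 * \<epsilon>"
          using k tail[of k] dist_triangle[of y 0 "x k"] by simp
        then show ?thesis by (auto simp: c_def dist_commute intro!: bexI[of _ N])
      qed
    qed
    then have "emeasure lebesgue (nbhd ?A \<epsilon>) \<le> emeasure lebesgue (\<Union>k\<in>{..N}. ball (c k) (2 * \<epsilon>))"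
      by (intro emeasure_mono) auto
    also have "\<dots> \<le> (\<Sum>k\<in>{..N}. emeasure lebesgue (ball (c k) (2 * \<epsilon>)))"
      by (intro emeasure_subadditive_finite) auto
    also have "\<dots> = (\<Sum>k\<in>{..N}. ennreal (V * \<epsilon> ^ ?n))"
      using \<epsilon> by (simp add: emeasure_ball V_def power_mult_distrib mult_ac)
    also have "\<dots> = ennreal ((real N + 1) * (V * \<epsilon> ^ ?n))"
      using \<open>V \<ge> 0\<close> \<epsilon> by (subst sum_ennreal) auto
    finally have "emeasure lebesgue (nbhd ?A \<epsilon>) / ennreal (\<epsilon> powr (real ?n - s)) \<le>
        ennreal ((real N + 1) * (V * \<epsilon> ^ ?n)) / ennreal (\<epsilon> powr (real ?n - s))"
      by (rule divide_right_mono_ennreal)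
    also have "\<dots> = ennreal ((real N + 1) * (V * \<epsilon> ^ ?n) / \<epsilon> powr (real ?n - s))"
      using \<open>V \<ge> 0\<close> \<epsilon> by (intro divide_ennreal) auto
    also have "(real N + 1) * (V * \<epsilon> ^ ?n) / \<epsilon> powr (real ?n - s) = (real N + 1) * V * \<epsilon> powr s"
      using \<epsilon> by (simp add: powr_diff powr_realpow)
    also have "\<dots> \<le> g \<epsilon>"
      unfolding g_def using N \<open>V \<ge> 0\<close> by (intro mult_right_mono) auto
    finally show ?thesis by (simp add: ennreal_leI)
  qed
  \<comment> \<open>Any positive power of \<open>\<epsilon>\<close> beats the logarithmic number of
    balls.\<close>
  have "((\<lambda>\<epsilon>. ln \<epsilon> * \<epsilon> powr s) \<longlongrightarrow> 0) (at_right 0)" "((\<lambda>\<epsilon>. \<epsilon> powr s) \<longlongrightarrow> 0) (at_right 0)"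
    using \<open>s > 0\<close> by real_asymp+
  then have "((\<lambda>\<epsilon>. V / ln q * (ln \<epsilon> * \<epsilon> powr s) + (2 - ln C / ln q) * V * \<epsilon> powr s) \<longlongrightarrow>
      V / ln q * 0 + (2 - ln C / ln q) * V * 0) (at_right 0)"
    by (intro tendsto_intros)
  moreover have "\<forall>\<^sub>F \<epsilon> in at_right 0.
      V / ln q * (ln \<epsilon> * \<epsilon> powr s) + (2 - ln C / ln q) * V * \<epsilon> powr s = g \<epsilon>"
    using eventually_at_right_less[of 0]
  proof eventually_elim
    case (elim \<epsilon>)
    then show ?case using \<open>C > 0\<close> by (simp add: g_def ln_div diff_divide_distrib algebra_simps)
  qed
  ultimately have "(g \<longlongrightarrow> 0) (at_right 0)" by (simp add: tendsto_cong)
  then have lim: "((\<lambda>\<epsilon>. ennreal (g \<epsilon>)) \<longlongrightarrow> 0) (at_right 0)"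
    using tendsto_ennrealI by fastforce
  have "\<forall>\<^sub>F \<epsilon> in at_right 0.
      emeasure lebesgue (nbhd ?A \<epsilon>) / ennreal (\<epsilon> powr (real ?n - s)) \<le> ennreal (g \<epsilon>)"
    using eventually_at_right_real[OF \<open>C > 0\<close>] 
    by eventually_elim (intro bound, auto)
  then have "upper_content s ?A \<le> Limsup (at_right 0) (\<lambda>\<epsilon>. ennreal (g \<epsilon>))"
    unfolding upper_content_def by (rule Limsup_mono)
  also have "\<dots> = 0" using lim by (intro lim_imp_Limsup) auto
  finally show "upper_content s ?A = 0" by simp
qed

subsection \<open>Orbits of the unit-time map\<close>

lemma unit_time_map_eqI:
  assumes "x \<in> flow_domain F 1" "integral_curve F u {0..1}" "u 0 = x"
  shows "unit_time_map F x = u 1"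
  unfolding unit_time_map_def flow_def
proof (rule the_equality)
  have seg: "closed_segment 0 1 = {0..1::real}" by (simp add: closed_segment_eq_real_ivl)
  show "\<exists>v. integral_curve F v (closed_segment 0 1) \<and> v 0 = x \<and> v 1 = u 1"
    using assms seg by auto
  fix y assume "\<exists>v. integral_curve F v (closed_segment 0 1) \<and> v 0 = x \<and> v 1 = y"
  then show "y = u 1"
    using assms unfolding flow_domain_def seg by fastforce
qed

text \<open>Precomposing \<open>F\<close> with the projection to the ball gives a globally Lipschitz
  field \<open>G\<close>, whose curves exist up to time 1. The Lyapunov form keeps the curve from
  \<open>x\<close> inside the ball, where \<open>G\<close> and \<open>F\<close> agree.\<close>

lemma unit_time_map_contracts:
  fixes F :: "'a::euclidean_space \<Rightarrow> 'a"
  assumes B: "bounded_bilinear B" "\<And>x y. B x y = B y x" "\<And>x. (norm x)\<^sup>2 \<le> B x x"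
    and F: "\<And>x. norm x \<le> R \<Longrightarrow> B x (F x) \<le> - a * B x x"
    and lip: "\<And>x y. norm x \<le> R \<Longrightarrow> norm y \<le> R \<Longrightarrow> norm (F x - F y) \<le> L * norm (x - y)"
    and "L > 0" "a \<ge> 0" "R > 0" and x: "B x x < R\<^sup>2"
  shows "x \<in> flow_domain F 1"
    and "B (unit_time_map F x) (unit_time_map F x) \<le> exp (- 2 * a) * B x x"
proof -
  define G where "G = F \<circ> closest_point (cball 0 R)"
  have cp: "norm (closest_point (cball 0 R) y) \<le> R" for y :: 'a
    using closest_point_in_set[of "cball 0 R" y] \<open>R > 0\<close> by auto
  have GF: "G y = F y" if "norm y \<le> R" for y
    using that by (simp add: G_def closest_point_self)
  have "norm (G y - G z) \<le> L * norm (y - z)" for y z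
  proof -
    have "norm (G y - G z) \<le> L * dist (closest_point (cball 0 R) y) (closest_point (cball 0 R) z)"
      unfolding G_def dist_norm o_def by (intro lip cp)
    also have "\<dots> \<le> L * dist y z"
      using \<open>L > 0\<close> \<open>R > 0\<close> by (intro mult_left_mono closest_point_lipschitz) auto
    finally show ?thesis by (simp add: dist_norm)
  qed
  then obtain u where u: "integral_curve G u {0..1}" "u 0 = x"
    using integral_curve_exists[OF \<open>L > 0\<close>, of 1 G x] by auto
  have "norm (u t) < R" if "t \<in> {0..1}" for t
    using lyapunov_decay(1)[OF B _ u(1) \<open>a \<ge> 0\<close> _ \<open>R > 0\<close> that] F GF x u(2) by auto
  then have uF: "integral_curve F u {0..1}"
    using u(1) GF unfolding integral_curve_def by (metis less_imp_le)
  \<comment> \<open>Uniqueness concerns all integral curves of \<open>F\<close> from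
    \<open>x\<close>, so each of them must first be confined to the ball where \<open>F\<close> is
    Lipschitz.\<close>
  have stays: "norm (v t) < R" if "integral_curve F v {0..1}" "v 0 = x" "t \<in> {0..1}" for v t
    using lyapunov_decay(1)[OF B F that(1) \<open>a \<ge> 0\<close> _ \<open>R > 0\<close> that(3)] x that(2) by auto
  have "v t = w t" if "integral_curve F v {0..1}" "v 0 = x" "integral_curve F w {0..1}" "w 0 = x"
    "t \<in> {0..1}" for v w t
    using that stays[OF that(1,2)] stays[OF that(3,4)]
    by (intro integral_curve_unique[of F v 1 "cball 0 R" w L t] lip) (auto simp: less_imp_le)
  then show dom: "x \<in> flow_domain F 1"
    using uF u(2) by (auto simp: flow_domain_def closed_segment_eq_real_ivl)
  show "B (unit_time_map F x) (unit_time_map F x) \<le> exp (- 2 * a) * B x x"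
    using lyapunov_decay(2)[OF B F uF \<open>a \<ge> 0\<close> _ \<open>R > 0\<close>, of 1] x u(2)
    by (simp add: unit_time_map_eqI[OF dom uF u(2)])
qed

theorem theorem11:
  fixes F :: "real^'n \<Rightarrow> real^'n" and r :: nat
  assumes "r \<ge> 1"
    and "Ck_near r F 0"
    and "hyperbolic_singularity F 0"
    and "\<forall>c\<in>complex_eigenvalues (jacobian F (at 0)). Re c < 0"
  shows "\<exists>\<rho>>0. \<forall>x :: nat \<Rightarrow> real^'n.
           norm (x 1) < \<rho> \<and> (\<forall>k\<ge>1. x (Suc k) = unit_time_map F (x k)) \<longrightarrow>
           (\<forall>k\<ge>1. x k \<in> flow_domain F 1) \<and> has_box_dim (x ` {1..}) 0"
proof -
  define A where "A = frechet_derivative F (at 0)"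
  have F0: "F 0 = 0" using assms(3) by (simp add: hyperbolic_singularity_def)
  have "F differentiable (at 0)"
    using assms(1,2) by (cases r) (auto simp: Ck_near_def)
  then have A: "linear A" "\<And>x. jacobian F (at 0) *v x = A x"
    by (simp_all add: A_def jacobian_def linear_frechet_derivative matrix_works)
  obtain B and a :: real where B: "bounded_bilinear B" "\<And>x y. B x y = B y x" "a > 0"
    "\<And>x. (norm x)\<^sup>2 \<le> B x x" "\<And>x. B x (A x) \<le> - a * B x x"
    using lyapunov_form[OF assms(4)] A(2) by metis
  interpret bounded_bilinear B by fact
  obtain K where K: "K > 0" "\<And>x y. norm (B x y) \<le> norm x * norm y * K" using pos_bounded by blast
  \<comment> \<open>Chosen so that the nonlinear remainder contributes at most
    \<open>a/2 * B x x\<close>, which leaves half of the linear decay rate.\<close>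
  define \<delta> where "\<delta> = a / (2 * K)"
  have \<delta>: "\<delta> > 0" using B(3) K(1) by (simp add: \<delta>_def)
  obtain R where R: "R > 0"
    "\<And>x y. norm x \<le> R \<Longrightarrow> norm y \<le> R \<Longrightarrow> norm (F x - F y - A (x - y)) \<le> \<delta> * norm (x - y)"
    using C1_linearization[OF assms(1,2) \<delta>] unfolding A_def dist_0_norm by metis
  have F: "B x (F x) \<le> - (a/2) * B x x" if "norm x \<le> R" for x
  proof -
    have "B x (F x - A x) \<le> norm x * (\<delta> * norm x) * K"
      using R(2)[OF that, of 0] R(1) K F0
      by (intro order_trans[OF abs_ge_self[of "B x (F x - A x)", folded real_norm_def]]
          order_trans[OF K(2)] mult_right_mono mult_left_mono) auto
    also have "\<dots> = a/2 * (norm x)\<^sup>2" using K(1) by (simp add: \<delta>_def power2_eq_square)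
    also have "\<dots> \<le> a/2 * B x x" using B(3,4) by (intro mult_left_mono) auto
    finally show ?thesis using B(5)[of x] by (simp add: diff_right)
  qed
  obtain L where L: "L > 0" "\<And>x. norm (A x) \<le> L * norm x"
    using linear_bounded_pos[OF A(1)] by blast
  have lip: "norm (F x - F y) \<le> (L + \<delta>) * norm (x - y)" if "norm x \<le> R" "norm y \<le> R" for x y
    using R(2)[OF that] L(2)[of "x - y"] norm_triangle_sub[of "F x - F y" "A (x - y)"]
    by (simp add: distrib_right)
  have pos: "L + \<delta> > 0" "a / 2 \<ge> 0" using L(1) \<delta> B(3) by auto
  have contracts: "x \<in> flow_domain F 1"
    "B (unit_time_map F x) (unit_time_map F x) \<le> exp (- 2 * (a/2)) * B x x" if "B x x < R\<^sup>2" for x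
    by (rule unit_time_map_contracts[OF B(1,2,4) F lip pos R(1) that]; assumption)+
  \<comment> \<open>Each step multiplies \<open>B\<close> by at most \<open>exp (- a)\<close>, which
    is the square of \<open>q\<close>. Since the sequence starts at index 1, \<open>C\<close> is
    chosen with \<open>C * q = R\<close>.\<close>
  define q C where "q = exp (- a / 2)" and "C = R * exp (a / 2)"
  have qC: "C * q = R" "exp (- a) = q\<^sup>2" "C > 0"
    using R(1) by (simp_all add: q_def C_def power2_eq_square mult.assoc flip: exp_add)
  have q: "0 < q" "q < 1" using B(3) by (simp_all add: q_def)
  show ?thesis
  \<comment> \<open>As \<open>B x x\<close> is at most \<open>K\<close> times the squared norm, this
    radius puts the initial point into the region where \<open>B x x < R\<^sup>2\<close>.\<close>
  proof (intro exI[of _ "R / sqrt K"] conjI allI impI)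
    show "R / sqrt K > 0" using R(1) K(1) by simp
    fix x :: "nat \<Rightarrow> real^'n"
    assume H: "norm (x 1) < R / sqrt K \<and> (\<forall>k\<ge>1. x (Suc k) = unit_time_map F (x k))"
    have "B (x 1) (x 1) \<le> (norm (x 1))\<^sup>2 * K"
      using K(2)[of "x 1" "x 1"] by (simp add: power2_eq_square)
    also have "\<dots> < (R / sqrt K)\<^sup>2 * K"
      using H K(1) by (intro mult_strict_right_mono power_strict_mono) auto
    also have "\<dots> = R\<^sup>2" using K(1) by (simp add: power_divide)
    finally have x1: "B (x 1) (x 1) < R\<^sup>2" .
    have dom: "x k \<in> flow_domain F 1"
      and contract: "B (x (Suc k)) (x (Suc k)) \<le> q\<^sup>2 * B (x k) (x k)"
      if "k \<ge> 1" "B (x k) (x k) < R\<^sup>2" for k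
      using contracts[OF that(2)] H that(1) qC(2) by simp_all
    \<comment> \<open>The induction also carries \<open>B (x k) (x k) < R\<^sup>2\<close>, because
      contraction and membership in the flow domain are available only in that region.\<close>
    have Bx: "B (x k) (x k) < R\<^sup>2 \<and> B (x k) (x k) \<le> (C * q ^ k)\<^sup>2" if "k \<ge> 1" for k
      using that
    proof (induction k rule: dec_induct)
      case base
      then show ?case using x1 qC(1) by simp
    next
      case (step k)
      have *: "B (x (Suc k)) (x (Suc k)) \<le> q\<^sup>2 * B (x k) (x k)"
        using step by (intro contract) auto
      also have "\<dots> \<le> q\<^sup>2 * (C * q ^ k)\<^sup>2" using step by (intro mult_left_mono) auto
      also have "\<dots> = (C * q ^ Suc k)\<^sup>2" by (simp add: power_mult_distrib mult_ac)
      finally have "B (x (Suc k)) (x (Suc k)) \<le> (C * q ^ Suc k)\<^sup>2" .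
      moreover have "q\<^sup>2 * B (x k) (x k) \<le> 1 * B (x k) (x k)"
        using q order_trans[OF zero_le_power2 B(4)[of "x k"]]
        by (intro mult_right_mono power_le_one) auto
      ultimately show ?case using * step by auto
    qed
    show "x k \<in> flow_domain F 1" if "k \<ge> 1" for k using dom[OF that] Bx[OF that] by simp
    have "norm (x k) \<le> C * q ^ k" if "k \<ge> 1" for k
    proof (rule power2_le_imp_le)
      show "(norm (x k))\<^sup>2 \<le> (C * q ^ k)\<^sup>2" using B(4)[of "x k"] Bx[OF that] by linarith
      show "0 \<le> C * q ^ k" using qC(3) q by simp
    qed
    then show "has_box_dim (x ` {1..}) 0" by (rule has_box_dim_geometric[OF q qC(3)])
  qed
qed

end
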